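(* Let $G$ be a finite $2$-group and let $n$ be a positive integer. Then $G$ admits a $\mathfrak{C}_{n+1}$-cover if and only if $n$ is even and $G\cong (C_2)^{n}$.
   Context: $(C_k)^m$ denotes the direct product of $m$ copies of the cyclic group $C_k$ of order $k$. A cover for a group $G$ is a set $\mathcal{C}$ of proper subgroups of $G$ whose set-theoretic union is $G$. It is irredundant if no proper subset of $\mathcal{C}$ is a cover for $G$, maximal if all members of $\mathcal{C}$ are maximal subgroups of $G$, and core-free if $D=\bigcap_{M\in\mathcal{C}}M$ is core-free in $G$, i.e. $\bigcap_{g\in G}g^{-1}Dg=1$. For a positive integer $m$, a $\mathfrak{C}_m$-cover for $G$ is an irredundant maximal core-free cover $\mathcal{C}$ for $G$ with $|\mathcal{C}|=m$. *)

theory Defs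
  imports "HOL-Algebra.Product_Groups"
begin

definition cyclic_power :: "nat \<Rightarrow> nat \<Rightarrow> (nat \<Rightarrow> int) monoid"
  where "cyclic_power k m = product_group {..<m} (\<lambda>_. integer_mod_group k)"

definition proper_subgroup :: "'a set \<Rightarrow> ('a, 'b) monoid_scheme \<Rightarrow> bool"
  where "proper_subgroup H G \<longleftrightarrow> subgroup H G \<and> H \<noteq> carrier G"

definition maximal_subgroup :: "'a set \<Rightarrow> ('a, 'b) monoid_scheme \<Rightarrow> bool"
  where "maximal_subgroup M G \<longleftrightarrow>
    proper_subgroup M G \<and> (\<forall>H. proper_subgroup H G \<and> M \<subseteq> H \<longrightarrow> H = M)"

definition normal_core :: "('a, 'b) monoid_scheme \<Rightarrow> 'a set \<Rightarrow> 'a set"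
  where "normal_core G D = (\<Inter>g\<in>carrier G. (inv\<^bsub>G\<^esub> g) <#\<^bsub>G\<^esub> D #>\<^bsub>G\<^esub> g)"

definition group_cover :: "('a, 'b) monoid_scheme \<Rightarrow> 'a set set \<Rightarrow> bool"
  where "group_cover G \<C> \<longleftrightarrow> (\<forall>H\<in>\<C>. proper_subgroup H G) \<and> \<Union>\<C> = carrier G"

definition irredundant_cover :: "('a, 'b) monoid_scheme \<Rightarrow> 'a set set \<Rightarrow> bool"
  where "irredundant_cover G \<C> \<longleftrightarrow>
    group_cover G \<C> \<and> (\<forall>\<D>. \<D> \<subset> \<C> \<longrightarrow> \<not> group_cover G \<D>)"

definition maximal_cover :: "('a, 'b) monoid_scheme \<Rightarrow> 'a set set \<Rightarrow> bool"
  where "maximal_cover G \<C> \<longleftrightarrow> group_cover G \<C> \<and> (\<forall>M\<in>\<C>. maximal_subgroup M G)"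

text \<open>A cover of a group is nonempty, so \<open>\<Inter>\<C>\<close> below is never the degenerate \<open>\<Inter>{} = UNIV\<close>.\<close>

definition core_free_cover :: "('a, 'b) monoid_scheme \<Rightarrow> 'a set set \<Rightarrow> bool"
  where "core_free_cover G \<C> \<longleftrightarrow> group_cover G \<C> \<and> normal_core G (\<Inter>\<C>) = {\<one>\<^bsub>G\<^esub>}"

text \<open>For \<open>m > 0\<close> (the only case of interest), \<open>card \<C> = m\<close> also forces \<open>\<C>\<close> to be finite.\<close>

definition C_cover :: "nat \<Rightarrow> ('a, 'b) monoid_scheme \<Rightarrow> 'a set set \<Rightarrow> bool"
  where "C_cover m G \<C> \<longleftrightarrow>
    irredundant_cover G \<C> \<and> maximal_cover G \<C> \<and> core_free_cover G \<C> \<and> card \<C> = m"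

end

theory Submission
  imports Defs "HOL-Algebra.Group_Action" "HOL-Algebra.Multiplicative_Group" "HOL-Computational_Algebra.Primes"
begin

text \<open>
  In a finite \<open>2\<close>-group every maximal subgroup \<open>M\<close> has index \<open>2\<close>, because normalizers grow.
  Given a cover \<open>\<C>\<close>, the map sending \<open>x\<close> to the set of members of \<open>\<C>\<close> that miss \<open>x\<close> is therefore
  a homomorphism into the subsets of \<open>\<C>\<close> under symmetric difference. It is injective since the
  cover is core-free. Its image \<open>V\<close> does not contain \<open>\<C>\<close> (covering) but contains every
  \<open>\<C> - {M}\<close> (irredundance), hence every \<open>{M, N}\<close>, hence every subset of even size. So \<open>|\<C>|\<close> is odd
  and \<open>V\<close> consists of exactly the even subsets, a copy of \<open>(C\<^sub>2)\<^sup>n\<close> with \<open>n = |\<C>| - 1\<close>.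
  Conversely, for \<open>|I|\<close> odd and greater than \<open>1\<close>, the even subsets of \<open>I\<close> are covered by the
  subgroups of those avoiding a given point of \<open>I\<close>.
\<close>

section \<open>Actions of p-groups and growth of normalizers\<close>

text \<open>The moved points are a disjoint union of orbits. By orbit-stabilizer each orbit has size
  a power of \<open>p\<close>, and the size is not 1 because a one-point orbit is a fixed
  point.\<close>

lemma (in group_action) p_group_dvd_card_moved_points:
  assumes "prime p" and "order G = p ^ k" and "finite E"
  shows "p dvd card (E - {x \<in> E. \<forall>g\<in>carrier G. \<phi> g x = x})" (is "p dvd card (E - ?F)")
proof -
  let ?O = "{orb \<in> orbits G E \<phi>. orb \<inter> ?F = {}}"
  have orb_fixed: "orbit G \<phi> x = {x}" if "x \<in> ?F" for x
    using that id_eq_one orbit_refl[of x] by (auto simp: orbit_def)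
  have U: "\<Union>?O = E - ?F"
  proof
    show "\<Union>?O \<subseteq> E - ?F"
      using orbits_coverture by blast
    show "E - ?F \<subseteq> \<Union>?O"
    proof
      fix x assume x: "x \<in> E - ?F"
      have "orbit G \<phi> x \<inter> ?F = {}"
      proof (rule ccontr)
        assume "orbit G \<phi> x \<inter> ?F \<noteq> {}"
        then obtain y where y: "y \<in> orbit G \<phi> x" "y \<in> ?F" by blast
        with x have "x \<in> orbit G \<phi> y" using orbit_sym by blast
        with orb_fixed[OF y(2)] have "x = y" by simp
        with x y show False by blast
      qed
      with x orbit_refl show "x \<in> \<Union>?O"
        by (auto simp: orbits_def)
    qed
  qed
  have "p dvd card orb" if "orb \<in> ?O" for orb
  proof -
    obtain x where x: "x \<in> E" "orb = orbit G \<phi> x"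
      using \<open>orb \<in> ?O\<close> by (auto simp: orbits_def)
    have "x \<notin> ?F" using that x orbit_refl by blast
    have "card orb dvd p ^ k"
      using orbit_stabilizer_theorem[OF x(1)] assms(2) x(2) by (metis dvd_triv_left)
    then obtain i where i: "card orb = p ^ i"
      using divides_primepow_nat[OF assms(1)] by blast
    have "card orb \<noteq> 1"
    proof
      assume "card orb = 1"
      then obtain y where "orb = {y}" by (rule card_1_singletonE)
      with x orbit_refl[of x] have "orbit G \<phi> x = {x}" by (metis singletonD)
      hence "x \<in> ?F" using x by (auto simp: orbit_def)
      with \<open>x \<notin> ?F\<close> show False ..
    qed
    with i show ?thesis by (cases i) auto
  qed
  moreover have "c1 \<inter> c2 = {}" if "c1 \<in> ?O" "c2 \<in> ?O" "c1 \<noteq> c2" for c1 c2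
    using disjoint_union that by blast
  moreover have "finite (\<Union>?O)" unfolding U using assms(3) by (rule finite_Diff)
  ultimately have "p dvd card (\<Union>?O)" by (intro dvd_partition) blast+
  then show ?thesis unfolding U .
qed

text \<open>The inverse turns right multiplication, which reverses products, into a homomorphism.
  The function is restricted because members of \<open>Bij\<close> are extensional.\<close>

lemma (in group) action_on_rcosets:
  assumes "subgroup H G"
  shows "group_action G (rcosets H) (\<lambda>g. \<lambda>R\<in>rcosets H. R #> inv g)"
proof -
  have sub: "R \<subseteq> carrier G" if "R \<in> rcosets H" for R
    using subgroup.rcosets_carrier[OF assms group_axioms that] .
  have cl: "R #> g \<in> rcosets H" if "R \<in> rcosets H" "g \<in> carrier G" for R g
  proof -
    obtain a where "a \<in> carrier G" "R = H #> a"
      using \<open>R \<in> rcosets H\<close> by (auto simp: RCOSETS_def)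
    with that show ?thesis
      using rcosetsI[of H "a \<otimes> g"] subgroup.subset[OF assms] by (simp add: coset_mult_assoc)
  qed
  have "bij_betw (\<lambda>R. R #> inv g) (rcosets H) (rcosets H)" if g: "g \<in> carrier G" for g
    by (rule bij_betwI[where g = "\<lambda>R. R #> g"]) (use g sub cl in \<open>auto simp: coset_mult_assoc\<close>)
  then have "(\<lambda>R\<in>rcosets H. R #> inv g) \<in> Bij (rcosets H)" if "g \<in> carrier G" for g
    using that by (simp add: Bij_def cong: bij_betw_cong)
  then show ?thesis
    unfolding group_action_def group_hom_def group_hom_axioms_def hom_def
    using group_BijGroup
    by (auto simp: BijGroup_def compose_def fun_eq_iff restrict_def cl sub coset_mult_assoc inv_mult_group group_axioms)
qed

text \<open>Let \<open>H\<close> act on its own right cosets. Their number is divisible by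
  \<open>p\<close>, hence so is the number of fixed cosets. The coset \<open>H\<close> is fixed, so
  there is another one, and its representative normalizes \<open>H\<close>.\<close>

lemma (in group) p_group_normalizer_grows:
  assumes "prime p" and "order G = p ^ k" and "subgroup H G" and "H \<noteq> carrier G"
  obtains g where "g \<in> carrier G" and "g \<notin> H" and "\<And>h. h \<in> H \<Longrightarrow> g \<otimes> h \<otimes> inv g \<in> H"
proof -
  let ?\<phi> = "\<lambda>g. \<lambda>R\<in>rcosets H. R #> inv g"
  let ?K = "G\<lparr>carrier := H\<rparr>"
  interpret H: group_action ?K "rcosets H" ?\<phi>
    by (rule group_action.induced_action[OF action_on_rcosets]) (use assms in auto)
  have Hs: "H \<subseteq> carrier G" by (simp add: assms(3) subgroup.subset)
  have fin: "finite (carrier G)"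
    using assms(1,2) by (simp add: order_gt_0_iff_finite[symmetric] prime_gt_0_nat)
  have lag: "card (rcosets H) * card H = p ^ k"
    using lagrange[OF assms(3)] assms(2) by simp
  then obtain i j where "card H = p ^ i" and j: "card (rcosets H) = p ^ j"
    by (metis assms(1) divides_primepow_nat dvd_triv_left dvd_triv_right)
  then have oK: "order ?K = p ^ i" by (simp add: order_def)
  have finE: "finite (rcosets H)"
    using fin by (simp add: RCOSETS_def)
  have "card (rcosets H) \<noteq> 1"
  proof
    assume "card (rcosets H) = 1"
    then have "card H = card (carrier G)" using lag assms(2) by (simp add: order_def)
    then show False using card_subset_eq[OF fin Hs] assms(4) by simp
  qed
  then have pE: "p dvd card (rcosets H)" using j by (cases j) auto
  txt \<open>The fixed points of \<open>H\<close> acting on its cosets are the \<open>H g\<close> with \<open>g\<close> normalizing \<open>H\<close>.\<close>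
  define F where "F = {R \<in> rcosets H. \<forall>h\<in>H. R #> inv h = R}"
  have "F = {R \<in> rcosets H. \<forall>h\<in>carrier ?K. ?\<phi> h R = R}"
    by (auto simp: F_def)
  then have "p dvd card (rcosets H - F)"
    using H.p_group_dvd_card_moved_points[OF assms(1) oK finE] by simp
  moreover have FE: "F \<subseteq> rcosets H" by (auto simp: F_def)
  ultimately have "p dvd card F"
    using pE finE by (metis card_Diff_subset card_mono dvd_diffD1 finite_subset)
  moreover have "H \<in> F"
    unfolding F_def using assms(3) subgroup.subgroup_in_rcosets[OF assms(3) group_axioms]
    by (simp add: subgroup.m_inv_closed subgroup.rcos_const[OF _ group_axioms])
  ultimately have "F \<noteq> {H}" using assms(1) by (auto simp: prime_nat_iff)
  then obtain R where R: "R \<in> F" "R \<noteq> H" using \<open>H \<in> F\<close> by blast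
  then obtain g where g: "g \<in> carrier G" "R = H #> g"
    by (auto simp: F_def RCOSETS_def)
  show ?thesis
  proof
    show "g \<in> carrier G" by fact
    show "g \<notin> H"
      using R g subgroup.rcos_const[OF assms(3) group_axioms] by auto
    fix h assume h: "h \<in> H"
    \<comment> \<open>Elements act through their inverses, so the fixed-point condition is used at
      \<open>inv h\<close> to get \<open>H g h = H g\<close>, that is, \<open>g h g^-1\<close> in
      \<open>H\<close>.\<close>
    then have "inv h \<in> H" using assms(3) by (simp add: subgroup.m_inv_closed)
    then have "H #> g #> inv (inv h) = H #> g" using R g by (auto simp: F_def)
    then have "H #> (g \<otimes> h) = H #> g"
      using h g Hs subgroup.mem_carrier[OF assms(3) h] by (simp add: coset_mult_assoc)
    then show "g \<otimes> h \<otimes> inv g \<in> H"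
      by (metis Hs assms(3) g(1) h m_closed repr_independenceD rcos_self subgroup.rcos_module_imp subset_eq
          group_axioms)
  qed
qed

section \<open>Maximal subgroups of 2-groups\<close>

text \<open>This form of index 2 says that non-membership in \<open>M\<close> is additive modulo 2,
  which is what makes the set of cover members missing an element a homomorphism.\<close>

lemma (in group) two_group_maximal_subgroup_index:
  assumes "order G = 2 ^ k" and "maximal_subgroup M G" and "x \<in> carrier G" and "y \<in> carrier G"
  shows "x \<otimes> y \<in> M \<longleftrightarrow> (x \<in> M \<longleftrightarrow> y \<in> M)"
proof -
  have M: "subgroup M G" "M \<noteq> carrier G"
    using assms(2) by (auto simp: maximal_subgroup_def proper_subgroup_def)
  have Ms: "M \<subseteq> carrier G" using M(1) by (rule subgroup.subset)
  interpret M: subgroup M G by fact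
  txt \<open>A normalizing element outside \<open>M\<close> has a power \<open>t \<notin> M\<close> with \<open>t\<^sup>2 \<in> M\<close>; then
    \<open>M \<union> M t\<close> is a subgroup, hence all of \<open>G\<close> by maximality.\<close>
  obtain g where g: "g \<in> carrier G" "g \<notin> M" and conj: "\<And>h. h \<in> M \<Longrightarrow> g \<otimes> h \<otimes> inv g \<in> M"
    using p_group_normalizer_grows[OF two_is_prime_nat assms(1) M] by blast
  have ex: "g [^] ((2::nat) ^ k) \<in> M"
    using pow_order_eq_1[OF g(1)] assms(1) by simp
  define j where "j = (LEAST j. g [^] ((2::nat) ^ j) \<in> M)"
  have j: "g [^] ((2::nat) ^ j) \<in> M" unfolding j_def by (rule LeastI[of _ k]) (rule ex)
  then have "j \<noteq> 0" using g by (metis nat_pow_eone power_0)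
  then obtain i where i: "j = Suc i" by (cases j) auto
  define t where "t = g [^] ((2::nat) ^ i)"
  have t: "t \<in> carrier G" by (simp add: t_def g)
  have tM: "t \<notin> M" unfolding t_def using not_less_Least[of i] i by (metis j_def lessI)
  have tt: "t \<otimes> t \<in> M"
    using j g by (simp add: t_def i nat_pow_mult mult_2)
  have conjn: "g [^] (n::nat) \<otimes> h \<otimes> inv (g [^] n) \<in> M" if "h \<in> M" for n h
  proof (induction n)
    case 0
    then show ?case using that by simp
  next
    case (Suc n)
    have "g [^] Suc n \<otimes> h \<otimes> inv (g [^] Suc n) = g \<otimes> (g [^] n \<otimes> h \<otimes> inv (g [^] n)) \<otimes> inv g"
      using g that by (simp only: nat_pow_Suc2 inv_mult_group m_assoc nat_pow_closed m_closed inv_closed M.mem_carrier)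
    then show ?case using conj[OF Suc] by simp
  qed
  then have conjt: "t \<otimes> h \<otimes> inv t \<in> M" if "h \<in> M" for h
    using that by (simp add: t_def)
  have MtI: "h \<otimes> t \<in> M #> t" if "h \<in> M" for h
    using that by (auto simp: r_coset_def)
  have MtE: "\<exists>h\<in>M. z = h \<otimes> t" if "z \<in> M #> t" for z
    using that by (auto simp: r_coset_def)
  have inv_tt: "inv t \<otimes> (t \<otimes> t) = t"
    using t by (simp add: m_assoc[symmetric])
  \<comment> \<open>This fact and the next two form the multiplication table of \<open>M\<close> and
    \<open>M t\<close>, that of the group of order 2. All rest on moving \<open>t\<close> past
    \<open>M\<close> by conjugation.\<close>
  have Mt_Mt: "a \<otimes> b \<in> M" if ab: "a \<in> M #> t" "b \<in> M #> t" for a b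
  proof -
    obtain h h' where h: "h \<in> M" "a = h \<otimes> t" "h' \<in> M" "b = h' \<otimes> t"
      using ab MtE by meson
    then have "a \<otimes> b = h \<otimes> (t \<otimes> h' \<otimes> inv t) \<otimes> (t \<otimes> t)"
      using t inv_tt by (simp add: m_assoc)
    then show ?thesis using h conjt tt by simp
  qed
  have Mt_M: "a \<otimes> b \<in> M #> t" if ab: "a \<in> M #> t" "b \<in> M" for a b
  proof -
    obtain h where h: "h \<in> M" "a = h \<otimes> t" using ab MtE by meson
    then have "a \<otimes> b = (h \<otimes> (t \<otimes> b \<otimes> inv t)) \<otimes> t"
      using t ab by (simp add: m_assoc)
    then show ?thesis using h conjt MtI ab by simp
  qed
  have M_Mt: "a \<otimes> b \<in> M #> t" if ab: "a \<in> M" "b \<in> M #> t" for a b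
  proof -
    obtain h where h: "h \<in> M" "b = h \<otimes> t" using ab MtE by meson
    then show ?thesis using MtI[of "a \<otimes> h"] ab t by (simp add: m_assoc)
  qed
  have M_Mt_disj: "z \<notin> M" if z: "z \<in> M #> t" for z
  proof
    assume "z \<in> M"
    obtain h where h: "h \<in> M" "z = h \<otimes> t" using z MtE by meson
    then have "t = inv h \<otimes> z" using t by (simp add: m_assoc[symmetric])
    moreover have "inv h \<otimes> z \<in> M" using h(1) \<open>z \<in> M\<close> by blast
    ultimately show False using tM by simp
  qed
  let ?K = "M \<union> (M #> t)"
  have "subgroup ?K G"
  proof (rule subgroupI)
    show "?K \<subseteq> carrier G" using Ms r_coset_subset_G t by simp
    show "?K \<noteq> {}" using M.one_closed by blast
  next
    fix a assume "a \<in> ?K"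
    moreover have "inv a \<in> M #> t" if a: "a \<in> M #> t"
    proof -
      have ac: "a \<in> carrier G" using a r_coset_subset_G[OF Ms t] by blast
      \<comment> \<open>The inverse of \<open>a\<close> is rewritten as \<open>(a a)^-1 a\<close>,
        where \<open>a a\<close> already lies in \<open>M\<close>.\<close>
      have "inv (a \<otimes> a) \<otimes> a \<in> M #> t" using Mt_Mt[OF a a] a by (intro M_Mt) auto
      then show ?thesis using ac by (simp add: inv_mult_group m_assoc)
    qed
    ultimately show "inv a \<in> ?K" by auto
  next
    fix a b assume "a \<in> ?K" "b \<in> ?K"
    then show "a \<otimes> b \<in> ?K" using Mt_Mt Mt_M M_Mt by auto
  qed
  moreover have "?K \<noteq> M" using rcos_self[OF t M(1)] tM by blast
  ultimately have "?K = carrier G"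
    using assms(2) by (auto simp: maximal_subgroup_def proper_subgroup_def)
  then consider "x \<in> M" "y \<in> M" | "x \<in> M" "y \<in> M #> t" | "x \<in> M #> t" "y \<in> M" | "x \<in> M #> t" "y \<in> M #> t"
    using assms(3,4) by blast
  then show ?thesis
    by cases (simp_all add: Mt_Mt Mt_M M_Mt M_Mt_disj)
qed

section \<open>The group of even subsets\<close>

text \<open>For finite \<open>I\<close> this is the binary even-weight code on \<open>I\<close>: a
  model of \<open>(C_2)^n\<close> in which all \<open>n + 1\<close> points of \<open>I\<close> play
  symmetric roles.\<close>

definition even_subsets :: "'i set \<Rightarrow> 'i set monoid"
  where "even_subsets I = \<lparr>carrier = {A. A \<subseteq> I \<and> even (card A)}, monoid.mult = sym_diff, one = {}\<rparr>"

lemma even_card_sym_diff: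
  assumes "finite A" and "finite B"
  shows "even (card (sym_diff A B)) \<longleftrightarrow> (even (card A) \<longleftrightarrow> even (card B))"
proof -
  have "card (sym_diff A B) = card (A - B) + card (B - A)"
    using assms by (intro card_Un_disjoint) auto
  moreover have "card A = card (A - B) + card (A \<inter> B)" "card B = card (B - A) + card (A \<inter> B)"
    using assms by (metis Int_Diff_disjoint Int_Diff_Un Int_commute Un_commute card_Un_disjoint finite_Diff finite_Int)+
  ultimately show ?thesis by presburger
qed

lemma group_even_subsets:
  assumes "finite I"
  shows "group (even_subsets I)"
proof (rule groupI)
  fix A B assume "A \<in> carrier (even_subsets I)" "B \<in> carrier (even_subsets I)"
  then show "A \<otimes>\<^bsub>even_subsets I\<^esub> B \<in> carrier (even_subsets I)"
    using even_card_sym_diff[of A B] finite_subset[OF _ assms]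
    by (auto simp: even_subsets_def)
qed (auto simp: even_subsets_def)

text \<open>Remove a point \<open>a\<close> of \<open>I\<close>. Membership of the other
  \<open>n\<close> points can be prescribed freely, and \<open>a\<close> then serves as the parity
  bit.\<close>

lemma even_subsets_iso_cyclic_power:
  assumes "finite I" and "card I = Suc n"
  shows "even_subsets I \<cong> cyclic_power 2 n"
proof -
  obtain a where a: "a \<in> I" using assms(2) by fastforce
  have "card (I - {a}) = card {..<n}" using a assms by simp
  then obtain f where f: "bij_betw f {..<n} (I - {a})"
    using assms(1) by (metis finite_Diff finite_lessThan finite_same_card_bij)
  let ?h = "\<lambda>A. \<lambda>i\<in>{..<n}. if f i \<in> A then 1 else 0 :: int"
  have hom: "?h \<in> hom (even_subsets I) (cyclic_power 2 n)"
  proof (rule homI)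
    fix A show "?h A \<in> carrier (cyclic_power 2 n)"
      by (auto simp: cyclic_power_def carrier_integer_mod_group)
    fix B show "?h (A \<otimes>\<^bsub>even_subsets I\<^esub> B) = ?h A \<otimes>\<^bsub>cyclic_power 2 n\<^esub> ?h B"
      by (rule ext) (auto simp: even_subsets_def cyclic_power_def)
  qed
  have "inj_on ?h (carrier (even_subsets I))"
  proof (rule inj_onI)
    fix A B assume A: "A \<in> carrier (even_subsets I)" and B: "B \<in> carrier (even_subsets I)"
      and eq: "?h A = ?h B"
    have "(f i \<in> A) = (f i \<in> B)" if "i < n" for i
      using fun_cong[OF eq, of i] that by (simp split: if_splits)
    then have "x \<in> A \<longleftrightarrow> x \<in> B" if "x \<in> I - {a}" for x
      using that bij_betw_imp_surj_on[OF f] by (metis imageE lessThan_iff)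
    \<comment> \<open>Equal coordinates allow a difference only at \<open>a\<close>, but a symmetric
      difference of even sets is even and cannot be \<open>{a}\<close>.\<close>
    then have "sym_diff A B \<subseteq> {a}"
      using A B by (auto simp: even_subsets_def)
    then have "sym_diff A B = {} \<or> sym_diff A B = {a}" by blast
    moreover have "sym_diff A B \<noteq> {a}"
    proof
      assume eq: "sym_diff A B = {a}"
      have "even (card (sym_diff A B))"
        using A B even_card_sym_diff[of A B] finite_subset[OF _ assms(1)] by (auto simp: even_subsets_def)
      then have "even (card {a})" by (simp only: eq)
      then show False by simp
    qed
    ultimately have "sym_diff A B = {}" by (simp only: simp_thms)
    then show "A = B" by blast
  qed
  moreover have "y \<in> ?h ` carrier (even_subsets I)" if y: "y \<in> carrier (cyclic_power 2 n)" for y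
  proof -
    have y01: "y i \<in> {0..<2}" if "i < n" for i
      using PiE_mem[of y "{..<n}" "\<lambda>_. {0..<2}" i] y that by (simp add: cyclic_power_def carrier_integer_mod_group)
    have y_undef: "y i = undefined" if "\<not> i < n" for i
      using PiE_arb[of y "{..<n}"] y that by (simp add: cyclic_power_def)
    define B where "B = f ` {i. i < n \<and> y i = 1}"
    have B: "B \<subseteq> I" "a \<notin> B" using f by (auto simp: B_def bij_betw_def)
    then have finB: "finite B" using assms(1) finite_subset by blast
    have f_B: "f i \<in> B \<longleftrightarrow> y i = 1" if "i < n" for i
      using f that by (auto simp: B_def bij_betw_def inj_on_def)
    \<comment> \<open>Adding \<open>a\<close> corrects the parity without changing any
      coordinate.\<close>
    define A where "A = (if even (card B) then B else insert a B)"
    have A: "A \<in> carrier (even_subsets I)"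
      using a B finB by (cases "even (card B)") (simp_all add: A_def even_subsets_def)
    have "f i \<noteq> a" if "i < n" for i
      using bij_betwE[OF f] that by blast
    then have f_A: "f i \<in> A \<longleftrightarrow> y i = 1" if "i < n" for i
      using f_B that by (simp add: A_def)
    have "?h A = y"
    proof
      fix i show "?h A i = y i"
        using f_A[of i] y01[of i] y_undef[of i] by (cases "i < n") auto
    qed
    with A show ?thesis by blast
  qed
  moreover have "?h ` carrier (even_subsets I) \<subseteq> carrier (cyclic_power 2 n)"
    by (rule hom_carrier[OF hom])
  ultimately have "?h \<in> iso (even_subsets I) (cyclic_power 2 n)"
    using hom by (simp add: iso_def bij_betw_def subset_antisym subsetI)
  then show ?thesis by (auto simp: is_iso_def)
qed

text \<open>The complements of \<open>{i}\<close> and \<open>{j}\<close> differ exactly in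
  \<open>{i, j}\<close>, so \<open>V\<close> contains all pairs. Every even set is built from the
  empty set by adding pairs.\<close>

lemma even_subsets_subset_closed:
  assumes "finite I" and "{} \<in> V" and "\<And>A B. A \<in> V \<Longrightarrow> B \<in> V \<Longrightarrow> sym_diff A B \<in> V"
    and "\<And>i. i \<in> I \<Longrightarrow> I - {i} \<in> V"
  shows "carrier (even_subsets I) \<subseteq> V"
proof
  have "A \<in> V" if "A \<subseteq> I" "even (card A)" for A
    using that
  proof (induction "card A" arbitrary: A rule: less_induct)
    case less
    have fA: "finite A" using less.prems(1) assms(1) finite_subset by blast
    show ?case
    proof (cases "A = {}")
      case True
      then show ?thesis using assms(2) by simp
    next
      case False
      then obtain i where i: "i \<in> A" by blast
      have "A \<noteq> {i}" using less.prems by auto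
      then obtain j where j: "j \<in> A" "j \<noteq> i" using i by blast
      have c: "card A = Suc (Suc (card (A - {i, j})))"
        using fA i j by (metis Diff_insert card_Suc_Diff1 finite_Diff insertE insert_Diff)
      then have "A - {i, j} \<in> V"
        using less.prems by (intro less.hyps) auto
      moreover have "sym_diff (I - {i}) (I - {j}) \<in> V"
        using i j less.prems by (intro assms(3,4)) auto
      ultimately have "sym_diff (A - {i, j}) (sym_diff (I - {i}) (I - {j})) \<in> V"
        by (rule assms(3))
      moreover have "sym_diff (A - {i, j}) (sym_diff (I - {i}) (I - {j})) = A"
        using i j less.prems by auto
      ultimately show ?thesis by simp
    qed
  qed
  then show "A \<in> V" if "A \<in> carrier (even_subsets I)" for A
    using that by (simp add: even_subsets_def)
qed

section \<open>From a cover to even subsets\<close>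

text \<open>A set closed under conjugation lies in each of its conjugates, hence in its own
  core.\<close>

lemma (in group) normal_core_eq_one:
  assumes "normal_core G D = {\<one>}" and "D \<subseteq> carrier G"
    and "\<And>g x. g \<in> carrier G \<Longrightarrow> x \<in> D \<Longrightarrow> g \<otimes> x \<otimes> inv g \<in> D"
  shows "D \<subseteq> {\<one>}"
proof
  fix x assume x: "x \<in> D"
  then have xc: "x \<in> carrier G" using assms(2) by blast
  have "x \<in> inv g <# D #> g" if g: "g \<in> carrier G" for g
  proof -
    have "x = inv g \<otimes> (g \<otimes> x \<otimes> inv g) \<otimes> g"
      using g xc by (simp add: m_assoc) (simp add: m_assoc[symmetric])
    then show ?thesis
      using assms(3)[OF g x] by (auto simp: l_coset_def r_coset_def)
  qed
  then have "x \<in> normal_core G D" by (auto simp: normal_core_def)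
  then show "x \<in> {\<one>}" using assms(1) by simp
qed

lemma (in group) two_group_C_cover_even_subsets:
  assumes "order G = 2 ^ k" and cover: "C_cover m G \<C>" and "m > 0"
  shows "odd m" and "G \<cong> even_subsets \<C>"
proof -
  have fin: "finite \<C>" and m: "card \<C> = m"
    using cover \<open>m > 0\<close> card.infinite by (fastforce simp: C_cover_def)+
  have union: "\<Union>\<C> = carrier G" and proper: "\<And>H. H \<in> \<C> \<Longrightarrow> proper_subgroup H G"
    using cover by (auto simp: C_cover_def irredundant_cover_def group_cover_def)
  have irr: "\<not> group_cover G \<D>" if "\<D> \<subset> \<C>" for \<D>
    using cover that by (auto simp: C_cover_def irredundant_cover_def)
  have max: "maximal_subgroup M G" if "M \<in> \<C>" for M
    using cover that by (auto simp: C_cover_def maximal_cover_def)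
  have core: "normal_core G (\<Inter>\<C>) = {\<one>}"
    using cover by (auto simp: C_cover_def core_free_cover_def)
  have par: "x \<otimes> y \<in> M \<longleftrightarrow> (x \<in> M \<longleftrightarrow> y \<in> M)"
    if "M \<in> \<C>" "x \<in> carrier G" "y \<in> carrier G" for M x y
    using two_group_maximal_subgroup_index[OF assms(1) max] that by blast
  have one_M: "\<one> \<in> M" if "M \<in> \<C>" for M
    using proper[OF that] by (simp add: proper_subgroup_def subgroup.one_closed)
  have inv_M: "inv x \<in> M \<longleftrightarrow> x \<in> M" if "M \<in> \<C>" "x \<in> carrier G" for M x
    using par[of M x "inv x"] one_M that by simp
  have "\<C> \<noteq> {}" using m \<open>m > 0\<close> by auto
  then have D_sub: "\<Inter>\<C> \<subseteq> carrier G" using union by blast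
  \<comment> \<open>By parity, \<open>g\<close> and \<open>inv g\<close> lie in the same members of
    the cover, so their contributions cancel.\<close>
  have "g \<otimes> x \<otimes> inv g \<in> \<Inter>\<C>" if "g \<in> carrier G" "x \<in> \<Inter>\<C>" for g x
    using that D_sub by (auto simp: par inv_M subset_iff)
  then have D: "\<Inter>\<C> \<subseteq> {\<one>}"
    using normal_core_eq_one[OF core D_sub] by blast

  define \<psi> where "\<psi> x = {M \<in> \<C>. x \<notin> M}" for x
  have mult: "\<psi> (x \<otimes> y) = sym_diff (\<psi> x) (\<psi> y)" if "x \<in> carrier G" "y \<in> carrier G" for x y
    using that par by (auto simp: \<psi>_def)
  have inj: "inj_on \<psi> (carrier G)"
  proof (rule inj_onI)
    fix x y assume xy: "x \<in> carrier G" "y \<in> carrier G" "\<psi> x = \<psi> y"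
    then have "x \<otimes> inv y \<in> \<Inter>\<C>"
      using par inv_M by (auto simp: \<psi>_def)
    then have "x \<otimes> inv y = \<one>" using D by blast
    then show "x = y" using xy by (metis inv_closed inv_equality inv_inv)
  qed
  let ?V = "\<psi> ` carrier G"
  have V_diff: "sym_diff A B \<in> ?V" if "A \<in> ?V" "B \<in> ?V" for A B
    using that mult by (smt (verit, best) image_iff m_closed)
  have "\<psi> \<one> = {}" using one_M by (auto simp: \<psi>_def)
  then have V_empty: "{} \<in> ?V" by (metis imageI one_closed)
  have V_co: "\<C> - {M} \<in> ?V" if M: "M \<in> \<C>" for M
  proof -
    have "\<Union>(\<C> - {M}) \<noteq> carrier G"
      using irr[of "\<C> - {M}"] M proper by (auto simp: group_cover_def)
    \<comment> \<open>Such an \<open>x\<close> is covered by \<open>M\<close> alone, so it is missed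
      by exactly the other members.\<close>
    then obtain x where x: "x \<in> carrier G" "x \<notin> \<Union>(\<C> - {M})" using union by blast
    then have "\<psi> x = \<C> - {M}" using union by (auto simp: \<psi>_def)
    with x show ?thesis by blast
  qed
  have E: "carrier (even_subsets \<C>) \<subseteq> ?V"
    using even_subsets_subset_closed[OF fin V_empty V_diff V_co] .
  have C_not: "\<C> \<notin> ?V" using union by (auto simp: \<psi>_def)
  \<comment> \<open>For even \<open>m\<close> the whole of \<open>\<C>\<close> would be an even
    subset and so lie in \<open>?V\<close>.\<close>
  with E show "odd m" using m by (auto simp: even_subsets_def)
  \<comment> \<open>As \<open>m\<close> is odd, an odd \<open>A\<close> has an even complement,
    which lies in \<open>?V\<close>. Their symmetric difference \<open>\<C>\<close> would then lie
    there too.\<close>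
  have "even (card A)" if A: "A \<in> ?V" for A
  proof (rule ccontr)
    assume odd: "odd (card A)"
    have "A \<subseteq> \<C>" using A by (auto simp: \<psi>_def)
    then have "even (card (\<C> - A))"
      using odd \<open>odd m\<close> m fin by (simp add: card_Diff_subset finite_subset card_mono)
    then have "\<C> - A \<in> ?V" using E by (auto simp: even_subsets_def)
    then have "sym_diff A (\<C> - A) \<in> ?V" using A V_diff by blast
    moreover have "sym_diff A (\<C> - A) = \<C>" using \<open>A \<subseteq> \<C>\<close> by blast
    ultimately show False using C_not by simp
  qed
  then have "?V \<subseteq> carrier (even_subsets \<C>)"
    by (auto simp: even_subsets_def \<psi>_def)
  with E have "?V = carrier (even_subsets \<C>)" by blast
  then have "\<psi> \<in> iso G (even_subsets \<C>)"
    using inj mult by (auto simp: iso_def bij_betw_def hom_def even_subsets_def)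
  then show "G \<cong> even_subsets \<C>" by (auto simp: is_iso_def)
qed

section \<open>From even subsets to a cover\<close>

text \<open>Since \<open>card I\<close> is odd, \<open>I\<close> itself is not an even subset, so
  every even subset avoids some point. Each \<open>I - {i}\<close> is even and avoids only
  \<open>i\<close>, which gives irredundance. Only the empty set avoids all points, which gives
  core-freeness.\<close>

lemma (in group) even_subsets_iso_C_cover:
  assumes "finite I" and "odd (card I)" and "card I > 1" and "G \<cong> even_subsets I"
  shows "\<exists>\<C>. C_cover (card I) G \<C>"
proof -
  let ?E = "even_subsets I"
  obtain \<psi> where \<psi>: "\<psi> \<in> iso G ?E" using assms(4) by (auto simp: is_iso_def)
  interpret E: group ?E by (rule group_even_subsets) fact
  have hom: "\<psi> \<in> hom G ?E" using \<psi> by (simp add: iso_def)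
  have inj: "inj_on \<psi> (carrier G)" and surj: "\<psi> ` carrier G = carrier ?E"
    using \<psi> by (auto simp: iso_def bij_betw_def)
  have one: "\<psi> \<one> = {}" using hom_one[OF hom group_axioms E.group_axioms] by (simp add: even_subsets_def)
  have mult: "\<psi> (x \<otimes> y) = sym_diff (\<psi> x) (\<psi> y)" if "x \<in> carrier G" "y \<in> carrier G" for x y
    using hom_mult[OF hom that] by (simp add: even_subsets_def)
  have sub: "\<psi> x \<subseteq> I" "even (card (\<psi> x))" if "x \<in> carrier G" for x
    using hom_in_carrier[OF hom that] by (auto simp: even_subsets_def)
  have inv: "\<psi> (inv x) = \<psi> x" if "x \<in> carrier G" for x
    using mult[of x "inv x"] one that by auto
  have ex: "\<exists>x\<in>carrier G. \<psi> x = A" if "A \<subseteq> I" "even (card A)" for A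
  proof -
    have "A \<in> \<psi> ` carrier G" using that by (simp add: surj even_subsets_def)
    then show ?thesis by blast
  qed

  define M where "M i = {x \<in> carrier G. i \<notin> \<psi> x}" for i
  have M_sub: "subgroup (M i) G" for i
    by (rule subgroupI) (use one in \<open>auto simp: M_def inv mult\<close>)
  have only: "\<exists>x. x \<in> M i \<and> (\<forall>j\<in>I. x \<in> M j \<longrightarrow> j = i)" if "i \<in> I" for i
  proof -
    have "even (card (I - {i}))" using that assms(1,2) by simp
    then obtain x where "x \<in> carrier G" "\<psi> x = I - {i}" using ex[of "I - {i}"] by auto
    then show ?thesis by (auto simp: M_def)
  qed
  have M_proper: "proper_subgroup (M i) G" if i: "i \<in> I" for i
  proof -
    \<comment> \<open>If \<open>i\<close> were the only point, \<open>M i\<close> would be the whole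
      (trivial) group.\<close>
    have "I \<noteq> {i}" using assms(3) by auto
    then obtain j where j: "j \<in> I" "j \<noteq> i" using i by blast
    then obtain x where "x \<in> M j" "x \<notin> M i" using only i by blast
    then have "M i \<noteq> carrier G" by (auto simp: M_def)
    then show ?thesis using M_sub by (simp add: proper_subgroup_def)
  qed
  have M_max: "maximal_subgroup (M i) G" if i: "i \<in> I" for i
    unfolding maximal_subgroup_def
  proof (intro conjI allI impI M_proper[OF i])
    fix H assume H: "proper_subgroup H G \<and> M i \<subseteq> H"
    then interpret H: subgroup H G by (simp add: proper_subgroup_def)
    show "H = M i"
    proof (rule ccontr)
      assume "H \<noteq> M i"
      then obtain h where h: "h \<in> H" "h \<notin> M i" using H by blast
      have hc: "h \<in> carrier G" using h by simp
      have "x \<in> H" if x: "x \<in> carrier G" for x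
      proof (cases "x \<in> M i")
        case False
        \<comment> \<open>Both sets \<open>\<psi> x\<close> and \<open>\<psi> h\<close> contain
          \<open>i\<close>, so \<open>i\<close> drops out of their symmetric difference.\<close>
        then have "x \<otimes> h \<in> M i" using x h hc by (auto simp: M_def mult)
        then have "x \<otimes> h \<otimes> inv h \<in> H" using H h by blast
        then show ?thesis using x hc by (simp add: m_assoc)
      qed (use H in blast)
      then show False using H H.subset by (auto simp: proper_subgroup_def)
    qed
  qed
  let ?C = "M ` I"
  have M_inj: "inj_on M I" using only by (metis inj_onI)
  have cover: "group_cover G ?C"
    unfolding group_cover_def
  proof
    show "\<forall>H\<in>?C. proper_subgroup H G" using M_proper by blast
    have "\<exists>i\<in>I. x \<in> M i" if x: "x \<in> carrier G" for x
    proof -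
      have "\<psi> x \<noteq> I" using sub(2)[OF x] assms(2) by auto
      then show ?thesis using sub(1)[OF x] x by (auto simp: M_def)
    qed
    then show "\<Union>?C = carrier G" by (auto simp: M_def)
  qed
  have "irredundant_cover G ?C"
    unfolding irredundant_cover_def
  proof (intro conjI allI impI cover)
    fix \<D> assume "\<D> \<subset> ?C"
    then obtain i where i: "i \<in> I" "M i \<notin> \<D>" "\<D> \<subseteq> ?C" by blast
    obtain x where x: "x \<in> M i" "\<forall>j\<in>I. x \<in> M j \<longrightarrow> j = i" using only[OF i(1)] by blast
    then have "x \<notin> \<Union>\<D>" using i by blast
    moreover have "x \<in> carrier G" using x by (simp add: M_def)
    ultimately show "\<not> group_cover G \<D>" by (auto simp: group_cover_def)
  qed
  moreover have "maximal_cover G ?C"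
    using cover M_max by (auto simp: maximal_cover_def)
  moreover have "core_free_cover G ?C"
    unfolding core_free_cover_def
  proof (intro conjI cover)
    \<comment> \<open>This keeps the intersection of the family inside the carrier.\<close>
    have "I \<noteq> {}" using assms(3) by auto
    have "x = \<one>" if "x \<in> \<Inter>?C" for x
    proof -
      have x: "x \<in> carrier G" "\<psi> x \<inter> I = {}" using that \<open>I \<noteq> {}\<close> by (auto simp: M_def)
      then have "\<psi> x = \<psi> \<one>" using sub(1)[OF x(1)] one by auto
      then show ?thesis using inj x(1) by (meson inj_onD one_closed)
    qed
    moreover have "\<one> \<in> \<Inter>?C" using one by (simp add: M_def)
    ultimately have "\<Inter>?C = {\<one>}" by blast
    then show "normal_core G (\<Inter>?C) = {\<one>}"
      using one_closed by (auto simp: normal_core_def l_coset_def r_coset_def)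
  qed
  ultimately have "C_cover (card I) G ?C"
    using card_image[OF M_inj] by (simp add: C_cover_def)
  then show ?thesis ..
qed

theorem theorem1p3:
  fixes G :: "('a, 'b) monoid_scheme" and n :: nat
  assumes "group G"
    and "finite (carrier G)"
    and "\<exists>k::nat. order G = 2 ^ k"
    and "n > 0"
  shows "(\<exists>\<C>. C_cover (n + 1) G \<C>) \<longleftrightarrow> even n \<and> G \<cong> cyclic_power 2 n"
proof
  interpret group G by fact
  assume "\<exists>\<C>. C_cover (n + 1) G \<C>"
  then obtain \<C> where C: "C_cover (n + 1) G \<C>" ..
  obtain k where k: "order G = 2 ^ k" using assms(3) by blast
  have "card \<C> = Suc n" using C by (simp add: C_cover_def)
  moreover from this have "finite \<C>" using card.infinite by fastforce
  ultimately show "even n \<and> G \<cong> cyclic_power 2 n"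
    using two_group_C_cover_even_subsets[OF k C] even_subsets_iso_cyclic_power iso_trans by fastforce
next
  interpret group G by fact
  assume n: "even n \<and> G \<cong> cyclic_power 2 n"
  \<comment> \<open>The interval \<open>{..n}\<close> has \<open>n + 1\<close> points: an odd number
    because \<open>n\<close> is even, and more than one because \<open>n\<close> is
    positive.\<close>
  have "cyclic_power 2 n \<cong> even_subsets {..n}"
    using even_subsets_iso_cyclic_power[of "{..n}" n] group_even_subsets group.iso_sym by force
  then have "G \<cong> even_subsets {..n}" using n iso_trans by blast
  then show "\<exists>\<C>. C_cover (n + 1) G \<C>"
    using even_subsets_iso_C_cover[of "{..n}"] n assms(4) by simp
qed

end
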